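(* Let $t_k\downarrow0$ and let $(x^k)_k$ be a sequence such that, for each $k$, $x^k$ is a stationary point of the relaxed problem $\min_{x\in X}\psi_p^{t}(x)$ for $t:=t_k$, with $x^k\to\bar x$ as $k\to\infty$, where $\bar x$ is such that $\mathcal{S}_p(\bar x)$ is nonempty and compact. Assume that $\bar x$ is upper-level regular, and that $(A_1^m)$ and $(A_2^m)$ hold at all $(\bar x,y,u)$ with $(y,u)\in\mathcal{S}_p(\bar x)$. Furthermore, let there exist, for each $k$, the stationarity data as in the definition of stationary point, and let $$\lim_{k\to\infty}e\left(\mathcal{S}_p^{t_k}(x^k),\ \mathcal{S}_p(\bar x)\right)=0.$$ Then $\bar x$ is a C-stationary point.
   Context: Setting. $F,f:\mathbb{R}^n\times\mathbb{R}^m\to\mathbb{R}$, $G:\mathbb{R}^n\to\mathbb{R}^p$, $g:\mathbb{R}^n\times\mathbb{R}^m\to\mathbb{R}^q$ are twice continuously differentiable. Let $X=\{x\in\mathbb{R}^n: G(x)\le 0\}$ and $S(x)=\arg\min_y\{f(x,y): g(x,y)\le 0\}$. Standing assumptions: $S(x)\neq\varnothing$ if $x\in X$ and $S(x)=\varnothing$ otherwise; $f$ and $g_1,\dots,g_q$ are convex in $y$; Slater condition: for every $x\in X$ there is $y(x)\in\mathbb{R}^m$ with $g_i(x,y(x))<0$ for all $i$. Let $\mathcal{L}(x,y,u)=\nabla_y f(x,y)+\sum_{i=1}^q u_i\nabla_y g_i(x,y)$ (components $\mathcal{L}_1,\dots,\mathcal{L}_m$) and $\mathcal{D}(x)=\{(y,u)\in\mathbb{R}^{m+q}: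 \mathcal{L}(x,y,u)=0,\ u\ge 0,\ g(x,y)\le 0,\ u^\top g(x,y)=0\}$; for $t>0$, $\mathcal{D}^t(x)=\{(y,u)\in\mathbb{R}^{m+q}: \mathcal{L}(x,y,u)=0,\ u\ge 0,\ g(x,y)\le 0,\ -u_ig_i(x,y)\le t,\ i=1,\dots,q\}$, assumed nonempty throughout. Put $\psi_p(x)=\max_{(y,u)\in\mathcal{D}(x)}F(x,y)$, $\psi_p^t(x)=\max_{(y,u)\in\mathcal{D}^t(x)}F(x,y)$ (optimal value functions; the value is understood as the supremum), $\mathcal{S}_p(x)=\{(y,u)\in\mathcal{D}(x):F(x,y)\ge\psi_p(x)\}$, $\mathcal{S}_p^t(x)=\{(y,u)\in\mathcal{D}^t(x):F(x,y)\ge\psi_p^t(x)\}$. $\mathrm{gph}$ denotes the graph. Excess: $e(A,B)=\sup_{a\in A}\inf_{b\in B}\|a-b\|$, with $e(\varnothing,B)=0$ and $e(A,\varnothing)=+\infty$ if $A\neq\varnothing$. $t_k\downarrow0$ means a sequence of positive numbers decreasing to $0$. Notation: for $\beta\in\mathbb{R}^m$, $\nabla_y g_i(x,y)\beta=\sum_{l=1}^m\beta_l\,\partial g_i/\partial y_l(x,y)$; matrices $\nabla_x\mathcal{L},\nabla_y\mathcal{L},\nabla G,\nabla_x g,\nabla_y g$ are Jacobians; $\nabla_{x,y}\mathcal{L}$ and $\nabla g$ are Jacobians with respect to $(x,y)$. Stationary point of the relaxed problem ($t>0$): $x^t$ such that there is $(y^t,u^t,\alpha^t,\beta^t,\gamma^t,\mu^t,\delta^t)\in\mathbb{R}^m\times\mathbb{R}^q\times\mathbb{R}^p\times\mathbb{R}^m\times\mathbb{R}^q\times\mathbb{R}^q\times\mathbb{R}^q$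 with: $(x^t,y^t,u^t)\in\mathrm{gph}\,\mathcal{S}_p^t$; $\nabla_xF(x^t,y^t)+\nabla G(x^t)^\top\alpha^t+\nabla_x\mathcal{L}(x^t,y^t,u^t)^\top\beta^t-\sum_{i=1}^q(\gamma_i^t-\delta_i^tu_i^t)\nabla_xg_i(x^t,y^t)=0$; $\nabla_yF(x^t,y^t)+\nabla_y\mathcal{L}(x^t,y^t,u^t)^\top\beta^t-\sum_{i=1}^q(\gamma_i^t-\delta_i^tu_i^t)\nabla_yg_i(x^t,y^t)=0$; $\nabla_yg_i(x^t,y^t)\beta^t+\mu_i^t+\delta_i^tg_i(x^t,y^t)=0$ for $i=1,\dots,q$; $\alpha_j^t\ge0,\ G_j(x^t)\le0,\ \alpha_j^tG_j(x^t)=0$ for $j=1,\dots,p$; and for $i=1,\dots,q$: $\gamma_i^t\ge0,\ g_i(x^t,y^t)\le0,\ \gamma_i^tg_i(x^t,y^t)=0$; $\mu_i^t\ge0,\ u_i^t\ge0,\ \mu_i^tu_i^t=0$; $\delta_i^t\ge0,\ -u_i^tg_i(x^t,y^t)\le t,\ \delta_i^t(u_i^tg_i(x^t,y^t)+t)=0$. Index sets at $(x,y,u)$: $\eta=\{i:u_i=0,\,g_i(x,y)<0\}$, $\theta=\{i:u_i=0,\,g_i(x,y)=0\}$, $\nu=\{i:u_i>0,\,g_i(x,y)=0\}$. C-stationary point: $\bar x$ such that there is $(\bar y,\bar u,\alpha,\beta,\gamma)$ with, for the index sets at $(\bar x,\bar y,\bar u)$: $(\bar x,\bar y,\bar u)\in\mathrm{gph}\,\mathcal{S}_p$;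 $\nabla_xF(\bar x,\bar y)+\sum_{i=1}^p\alpha_i\nabla G_i(\bar x)+\sum_{l=1}^m\beta_l\nabla_x\mathcal{L}_l(\bar x,\bar y,\bar u)+\sum_{i=1}^q\gamma_i\nabla_xg_i(\bar x,\bar y)=0$; $\nabla_yF(\bar x,\bar y)+\sum_{l=1}^m\beta_l\nabla_y\mathcal{L}_l(\bar x,\bar y,\bar u)+\sum_{i=1}^q\gamma_i\nabla_yg_i(\bar x,\bar y)=0$; $\alpha_j\ge0,\ G_j(\bar x)\le0,\ \alpha_jG_j(\bar x)=0$ for all $j$; $\nabla_yg_i(\bar x,\bar y)\beta=0$ for $i\in\nu$; $\gamma_i=0$ for $i\in\eta$; $\gamma_i\,\nabla_yg_i(\bar x,\bar y)\beta\ge0$ for $i\in\theta$. Upper-level regular at $\bar x$: $[\alpha\ge0,\ \alpha^\top G(\bar x)=0,\ \nabla G(\bar x)^\top\alpha=0]\Rightarrow\alpha=0$. M-multiplier sets at $(x,y,u)$: $\Lambda^{em}(x,y,u,0)$ is the set of $(\beta,\gamma)\in\mathbb{R}^{m+q}$ with $\nabla_yg_i(x,y)\beta=0$ for $i\in\nu$, $\gamma_i=0$ for $i\in\eta$, for each $i\in\theta$ either ($\gamma_i>0$ and $\nabla_yg_i(x,y)\beta>0$) or $\gamma_i\nabla_yg_i(x,y)\beta=0$, and $\nabla_{x,y}\mathcal{L}(x,y,u)^\top\beta+\nabla g(x,y)^\top\gamma=0$. $\Lambda^{em}_y(x,y,u,0)$ is defined in the same way with the last equation replaced by $\nabla_y\mathcal{L}(x,y,u)^\top\beta+\nabla_yg(x,y)^\top\gamma=0$.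 $(A_1^m)$ at $(x,y,u)$: $(\beta,\gamma)\in\Lambda^{em}(x,y,u,0)\Rightarrow\beta=0,\gamma=0$. $(A_2^m)$ at $(x,y,u)$: $(\beta,\gamma)\in\Lambda_y^{em}(x,y,u,0)\Rightarrow\nabla_x\mathcal{L}(x,y,u)^\top\beta+\nabla_xg(x,y)^\top\gamma=0$. *)

theory Defs
  imports "HOL-Analysis.Analysis"
begin

text \<open>Pessimistic bilevel optimization. Pairs \<open>(x, y)\<close> have \<open>x\<close> in \<open>real ^ 'n\<close> (upper level) and
  \<open>y\<close> in \<open>real ^ 'm\<close> (lower level); on vectors, \<open>\<le>\<close> is the componentwise order.\<close>

definition twice_cont_diff :: "('a::real_normed_vector \<Rightarrow> 'b::real_normed_vector) \<Rightarrow> bool" where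
  "twice_cont_diff h \<longleftrightarrow>
    (\<exists>(h' :: 'a \<Rightarrow> 'a \<Rightarrow>\<^sub>L 'b) (h'' :: 'a \<Rightarrow> 'a \<Rightarrow>\<^sub>L 'a \<Rightarrow>\<^sub>L 'b).
      (\<forall>z. (h has_derivative blinfun_apply (h' z)) (at z)) \<and>
      (\<forall>z. (h' has_derivative blinfun_apply (h'' z)) (at z)) \<and>
      continuous_on UNIV h'')"

definition grad :: "(real ^ 'k \<Rightarrow> real) \<Rightarrow> real ^ 'k \<Rightarrow> real ^ 'k" where
  "grad h z = (\<chi> i. frechet_derivative h (at z) (axis i 1))"

abbreviation grad_x :: "((real ^ 'n) \<times> (real ^ 'm) \<Rightarrow> real) \<Rightarrow> real ^ 'n \<Rightarrow> real ^ 'm \<Rightarrow> real ^ 'n" where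
  "grad_x h x y \<equiv> grad (\<lambda>x'. h (x', y)) x"

abbreviation grad_y :: "((real ^ 'n) \<times> (real ^ 'm) \<Rightarrow> real) \<Rightarrow> real ^ 'n \<Rightarrow> real ^ 'm \<Rightarrow> real ^ 'm" where
  "grad_y h x y \<equiv> grad (\<lambda>y'. h (x, y')) y"

abbreviation Jac_x :: "((real ^ 'n) \<times> (real ^ 'm) \<Rightarrow> real ^ 'k) \<Rightarrow> real ^ 'n \<Rightarrow> real ^ 'm \<Rightarrow> real ^ 'n ^ 'k" where
  "Jac_x h x y \<equiv> jacobian (\<lambda>x'. h (x', y)) (at x)"

abbreviation Jac_y :: "((real ^ 'n) \<times> (real ^ 'm) \<Rightarrow> real ^ 'k) \<Rightarrow> real ^ 'n \<Rightarrow> real ^ 'm \<Rightarrow> real ^ 'm ^ 'k" where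
  "Jac_y h x y \<equiv> jacobian (\<lambda>y'. h (x, y')) (at y)"

text \<open>The transpose of the Jacobian of \<open>h\<close> in the joint variable \<open>(x, y)\<close>, applied to \<open>v\<close>. Since
  \<open>(real ^ 'n) \<times> (real ^ 'm)\<close> is not a type of coordinate vectors, the transpose is taken as the adjoint
  of the total derivative.\<close>

abbreviation Jac_xy_transpose ::
    "((real ^ 'n) \<times> (real ^ 'm) \<Rightarrow> real ^ 'k) \<Rightarrow> real ^ 'n \<Rightarrow> real ^ 'm \<Rightarrow> real ^ 'k \<Rightarrow> (real ^ 'n) \<times> (real ^ 'm)" where
  "Jac_xy_transpose h x y v \<equiv> adjoint (frechet_derivative h (at (x, y))) v"

definition dyg :: "((real ^ 'n) \<times> (real ^ 'm) \<Rightarrow> real ^ 'q) \<Rightarrow> real ^ 'n \<Rightarrow> real ^ 'm \<Rightarrow> 'q \<Rightarrow> real ^ 'm \<Rightarrow> real" where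
  "dyg g x y i \<beta> = (\<Sum>l\<in>UNIV. \<beta> $ l * grad_y (\<lambda>z. g z $ i) x y $ l)"

definition upper_feasible :: "(real ^ 'n \<Rightarrow> real ^ 'p) \<Rightarrow> (real ^ 'n) set" where
  "upper_feasible G = {x. G x \<le> 0}"

definition lower_solutions ::
    "((real ^ 'n) \<times> (real ^ 'm) \<Rightarrow> real) \<Rightarrow> ((real ^ 'n) \<times> (real ^ 'm) \<Rightarrow> real ^ 'q) \<Rightarrow> real ^ 'n \<Rightarrow> (real ^ 'm) set" where
  "lower_solutions f g x = {y. is_arg_min (\<lambda>y. f (x, y)) (\<lambda>y. g (x, y) \<le> 0) y}"

definition Lag ::
    "((real ^ 'n) \<times> (real ^ 'm) \<Rightarrow> real) \<Rightarrow> ((real ^ 'n) \<times> (real ^ 'm) \<Rightarrow> real ^ 'q) \<Rightarrow> real ^ 'q \<Rightarrow>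
      (real ^ 'n) \<times> (real ^ 'm) \<Rightarrow> real ^ 'm" where
  "Lag f g u = (\<lambda>(x, y). grad_y f x y + (\<Sum>i\<in>UNIV. u $ i *\<^sub>R grad_y (\<lambda>z. g z $ i) x y))"

definition KKT ::
    "((real ^ 'n) \<times> (real ^ 'm) \<Rightarrow> real) \<Rightarrow> ((real ^ 'n) \<times> (real ^ 'm) \<Rightarrow> real ^ 'q) \<Rightarrow> real ^ 'n \<Rightarrow>
      ((real ^ 'm) \<times> (real ^ 'q)) set" where
  "KKT f g x = {(y, u). Lag f g u (x, y) = 0 \<and> 0 \<le> u \<and> g (x, y) \<le> 0 \<and> u \<bullet> g (x, y) = 0}"

definition KKT_relaxed ::
    "((real ^ 'n) \<times> (real ^ 'm) \<Rightarrow> real) \<Rightarrow> ((real ^ 'n) \<times> (real ^ 'm) \<Rightarrow> real ^ 'q) \<Rightarrow> real \<Rightarrow> real ^ 'n \<Rightarrow>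
      ((real ^ 'm) \<times> (real ^ 'q)) set" where
  "KKT_relaxed f g t x = {(y, u). Lag f g u (x, y) = 0 \<and> 0 \<le> u \<and> g (x, y) \<le> 0 \<and>
      (\<forall>i. - (u $ i * g (x, y) $ i) \<le> t)}"

definition psi_p ::
    "((real ^ 'n) \<times> (real ^ 'm) \<Rightarrow> real) \<Rightarrow> ((real ^ 'n) \<times> (real ^ 'm) \<Rightarrow> real) \<Rightarrow>
      ((real ^ 'n) \<times> (real ^ 'm) \<Rightarrow> real ^ 'q) \<Rightarrow> real ^ 'n \<Rightarrow> ereal" where
  "psi_p F f g x = (SUP (y, u)\<in>KKT f g x. ereal (F (x, y)))"

definition psi_p_relaxed ::
    "((real ^ 'n) \<times> (real ^ 'm) \<Rightarrow> real) \<Rightarrow> ((real ^ 'n) \<times> (real ^ 'm) \<Rightarrow> real) \<Rightarrow>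
      ((real ^ 'n) \<times> (real ^ 'm) \<Rightarrow> real ^ 'q) \<Rightarrow> real \<Rightarrow> real ^ 'n \<Rightarrow> ereal" where
  "psi_p_relaxed F f g t x = (SUP (y, u)\<in>KKT_relaxed f g t x. ereal (F (x, y)))"

definition S_p ::
    "((real ^ 'n) \<times> (real ^ 'm) \<Rightarrow> real) \<Rightarrow> ((real ^ 'n) \<times> (real ^ 'm) \<Rightarrow> real) \<Rightarrow>
      ((real ^ 'n) \<times> (real ^ 'm) \<Rightarrow> real ^ 'q) \<Rightarrow> real ^ 'n \<Rightarrow> ((real ^ 'm) \<times> (real ^ 'q)) set" where
  "S_p F f g x = {(y, u) \<in> KKT f g x. ereal (F (x, y)) \<ge> psi_p F f g x}"

definition S_p_relaxed ::
    "((real ^ 'n) \<times> (real ^ 'm) \<Rightarrow> real) \<Rightarrow> ((real ^ 'n) \<times> (real ^ 'm) \<Rightarrow> real) \<Rightarrow>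
      ((real ^ 'n) \<times> (real ^ 'm) \<Rightarrow> real ^ 'q) \<Rightarrow> real \<Rightarrow> real ^ 'n \<Rightarrow> ((real ^ 'm) \<times> (real ^ 'q)) set" where
  "S_p_relaxed F f g t x = {(y, u) \<in> KKT_relaxed f g t x. ereal (F (x, y)) \<ge> psi_p_relaxed F f g t x}"

text \<open>In \<open>ennreal\<close> the supremum of the empty set is \<open>0\<close> and its infimum is \<open>\<infinity>\<close>, which gives the usual
  conventions \<open>excess {} B = 0\<close> and \<open>excess A {} = \<infinity>\<close> for nonempty \<open>A\<close>.\<close>

definition excess :: "'a::real_normed_vector set \<Rightarrow> 'a set \<Rightarrow> ennreal" where
  "excess A B = (SUP a\<in>A. INF b\<in>B. ennreal (norm (a - b)))"

definition relaxed_stationary ::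
    "((real ^ 'n) \<times> (real ^ 'm) \<Rightarrow> real) \<Rightarrow> ((real ^ 'n) \<times> (real ^ 'm) \<Rightarrow> real) \<Rightarrow> (real ^ 'n \<Rightarrow> real ^ 'p) \<Rightarrow>
      ((real ^ 'n) \<times> (real ^ 'm) \<Rightarrow> real ^ 'q) \<Rightarrow> real \<Rightarrow> real ^ 'n \<Rightarrow> bool" where
  "relaxed_stationary F f G g t x \<longleftrightarrow>
    (\<exists>(y :: real ^ 'm) (u :: real ^ 'q) (\<alpha> :: real ^ 'p) (\<beta> :: real ^ 'm)
       (\<gamma> :: real ^ 'q) (\<mu> :: real ^ 'q) (\<delta> :: real ^ 'q).
      (y, u) \<in> S_p_relaxed F f g t x \<and>
      grad_x F x y + transpose (jacobian G (at x)) *v \<alpha> + transpose (Jac_x (Lag f g u) x y) *v \<beta>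
        - (\<Sum>i\<in>UNIV. (\<gamma> $ i - \<delta> $ i * u $ i) *\<^sub>R grad_x (\<lambda>z. g z $ i) x y) = 0 \<and>
      grad_y F x y + transpose (Jac_y (Lag f g u) x y) *v \<beta>
        - (\<Sum>i\<in>UNIV. (\<gamma> $ i - \<delta> $ i * u $ i) *\<^sub>R grad_y (\<lambda>z. g z $ i) x y) = 0 \<and>
      (\<forall>i. dyg g x y i \<beta> + \<mu> $ i + \<delta> $ i * g (x, y) $ i = 0) \<and>
      (\<forall>j. \<alpha> $ j \<ge> 0 \<and> G x $ j \<le> 0 \<and> \<alpha> $ j * G x $ j = 0) \<and>
      (\<forall>i. \<gamma> $ i \<ge> 0 \<and> g (x, y) $ i \<le> 0 \<and> \<gamma> $ i * g (x, y) $ i = 0) \<and>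
      (\<forall>i. \<mu> $ i \<ge> 0 \<and> u $ i \<ge> 0 \<and> \<mu> $ i * u $ i = 0) \<and>
      (\<forall>i. \<delta> $ i \<ge> 0 \<and> - (u $ i * g (x, y) $ i) \<le> t \<and> \<delta> $ i * (u $ i * g (x, y) $ i + t) = 0))"

definition idx_eta :: "((real ^ 'n) \<times> (real ^ 'm) \<Rightarrow> real ^ 'q) \<Rightarrow> real ^ 'n \<Rightarrow> real ^ 'm \<Rightarrow> real ^ 'q \<Rightarrow> 'q set" where
  "idx_eta g x y u = {i. u $ i = 0 \<and> g (x, y) $ i < 0}"

definition idx_theta :: "((real ^ 'n) \<times> (real ^ 'm) \<Rightarrow> real ^ 'q) \<Rightarrow> real ^ 'n \<Rightarrow> real ^ 'm \<Rightarrow> real ^ 'q \<Rightarrow> 'q set" where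
  "idx_theta g x y u = {i. u $ i = 0 \<and> g (x, y) $ i = 0}"

definition idx_nu :: "((real ^ 'n) \<times> (real ^ 'm) \<Rightarrow> real ^ 'q) \<Rightarrow> real ^ 'n \<Rightarrow> real ^ 'm \<Rightarrow> real ^ 'q \<Rightarrow> 'q set" where
  "idx_nu g x y u = {i. u $ i > 0 \<and> g (x, y) $ i = 0}"

definition C_stationary ::
    "((real ^ 'n) \<times> (real ^ 'm) \<Rightarrow> real) \<Rightarrow> ((real ^ 'n) \<times> (real ^ 'm) \<Rightarrow> real) \<Rightarrow> (real ^ 'n \<Rightarrow> real ^ 'p) \<Rightarrow>
      ((real ^ 'n) \<times> (real ^ 'm) \<Rightarrow> real ^ 'q) \<Rightarrow> real ^ 'n \<Rightarrow> bool" where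
  "C_stationary F f G g x \<longleftrightarrow>
    (\<exists>(y :: real ^ 'm) (u :: real ^ 'q) (\<alpha> :: real ^ 'p) (\<beta> :: real ^ 'm) (\<gamma> :: real ^ 'q).
      (y, u) \<in> S_p F f g x \<and>
      grad_x F x y + (\<Sum>j\<in>UNIV. \<alpha> $ j *\<^sub>R grad (\<lambda>x'. G x' $ j) x)
        + (\<Sum>l\<in>UNIV. \<beta> $ l *\<^sub>R grad_x (\<lambda>z. Lag f g u z $ l) x y)
        + (\<Sum>i\<in>UNIV. \<gamma> $ i *\<^sub>R grad_x (\<lambda>z. g z $ i) x y) = 0 \<and>
      grad_y F x y
        + (\<Sum>l\<in>UNIV. \<beta> $ l *\<^sub>R grad_y (\<lambda>z. Lag f g u z $ l) x y)
        + (\<Sum>i\<in>UNIV. \<gamma> $ i *\<^sub>R grad_y (\<lambda>z. g z $ i) x y) = 0 \<and>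
      (\<forall>j. \<alpha> $ j \<ge> 0 \<and> G x $ j \<le> 0 \<and> \<alpha> $ j * G x $ j = 0) \<and>
      (\<forall>i\<in>idx_nu g x y u. dyg g x y i \<beta> = 0) \<and>
      (\<forall>i\<in>idx_eta g x y u. \<gamma> $ i = 0) \<and>
      (\<forall>i\<in>idx_theta g x y u. \<gamma> $ i * dyg g x y i \<beta> \<ge> 0))"

definition upper_level_regular :: "(real ^ 'n \<Rightarrow> real ^ 'p) \<Rightarrow> real ^ 'n \<Rightarrow> bool" where
  "upper_level_regular G x \<longleftrightarrow>
    (\<forall>\<alpha> :: real ^ 'p. 0 \<le> \<alpha> \<and> \<alpha> \<bullet> G x = 0 \<and> transpose (jacobian G (at x)) *v \<alpha> = 0 \<longrightarrow> \<alpha> = 0)"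

definition M_sign ::
    "((real ^ 'n) \<times> (real ^ 'm) \<Rightarrow> real ^ 'q) \<Rightarrow> real ^ 'n \<Rightarrow> real ^ 'm \<Rightarrow> real ^ 'q \<Rightarrow>
      real ^ 'm \<Rightarrow> real ^ 'q \<Rightarrow> bool" where
  "M_sign g x y u \<beta> \<gamma> \<longleftrightarrow>
    (\<forall>i\<in>idx_nu g x y u. dyg g x y i \<beta> = 0) \<and>
    (\<forall>i\<in>idx_eta g x y u. \<gamma> $ i = 0) \<and>
    (\<forall>i\<in>idx_theta g x y u. (\<gamma> $ i > 0 \<and> dyg g x y i \<beta> > 0) \<or> \<gamma> $ i * dyg g x y i \<beta> = 0)"

definition Lambda_em ::
    "((real ^ 'n) \<times> (real ^ 'm) \<Rightarrow> real) \<Rightarrow> ((real ^ 'n) \<times> (real ^ 'm) \<Rightarrow> real ^ 'q) \<Rightarrow>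
      real ^ 'n \<Rightarrow> real ^ 'm \<Rightarrow> real ^ 'q \<Rightarrow> ((real ^ 'm) \<times> (real ^ 'q)) set" where
  "Lambda_em f g x y u = {(\<beta>, \<gamma>). M_sign g x y u \<beta> \<gamma> \<and>
      Jac_xy_transpose (Lag f g u) x y \<beta> + Jac_xy_transpose g x y \<gamma> = 0}"

definition Lambda_em_y ::
    "((real ^ 'n) \<times> (real ^ 'm) \<Rightarrow> real) \<Rightarrow> ((real ^ 'n) \<times> (real ^ 'm) \<Rightarrow> real ^ 'q) \<Rightarrow>
      real ^ 'n \<Rightarrow> real ^ 'm \<Rightarrow> real ^ 'q \<Rightarrow> ((real ^ 'm) \<times> (real ^ 'q)) set" where
  "Lambda_em_y f g x y u = {(\<beta>, \<gamma>). M_sign g x y u \<beta> \<gamma> \<and>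
      transpose (Jac_y (Lag f g u) x y) *v \<beta> + transpose (Jac_y g x y) *v \<gamma> = 0}"

definition A1m ::
    "((real ^ 'n) \<times> (real ^ 'm) \<Rightarrow> real) \<Rightarrow> ((real ^ 'n) \<times> (real ^ 'm) \<Rightarrow> real ^ 'q) \<Rightarrow>
      real ^ 'n \<Rightarrow> real ^ 'm \<Rightarrow> real ^ 'q \<Rightarrow> bool" where
  "A1m f g x y u \<longleftrightarrow> (\<forall>(\<beta>, \<gamma>)\<in>Lambda_em f g x y u. \<beta> = 0 \<and> \<gamma> = 0)"

definition A2m ::
    "((real ^ 'n) \<times> (real ^ 'm) \<Rightarrow> real) \<Rightarrow> ((real ^ 'n) \<times> (real ^ 'm) \<Rightarrow> real ^ 'q) \<Rightarrow>
      real ^ 'n \<Rightarrow> real ^ 'm \<Rightarrow> real ^ 'q \<Rightarrow> bool" where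
  "A2m f g x y u \<longleftrightarrow> (\<forall>(\<beta>, \<gamma>)\<in>Lambda_em_y f g x y u.
      transpose (Jac_x (Lag f g u) x y) *v \<beta> + transpose (Jac_x g x y) *v \<gamma> = 0)"

end

theory Submission
  imports Defs
begin

text \<open>Write \<open>c\<^sub>i = \<delta>\<^sub>i u\<^sub>i - \<gamma>\<^sub>i\<close> and \<open>b\<^sub>i = \<nabla>\<^sub>y g\<^sub>i \<beta>\<close>. Eliminating \<open>\<mu>\<close> and \<open>\<delta>\<close>, the complementarity
  conditions of a relaxed stationary point give \<open>c\<^sub>i b\<^sub>i \<ge> 0\<close> and \<open>b\<^sub>i u\<^sub>i + c\<^sub>i g\<^sub>i = 0\<close>, two conditions
  that are homogeneous in the multipliers, closed under limits, and that contain the C-sign conditions.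
  Normalising the multipliers and passing to a limit yields a Fritz John system at \<open>xbar\<close>. If the
  factor of the objective vanished, then the equation in \<open>y\<close>, tested with \<open>\<beta>\<close>, would read
  \<open>\<beta> \<bullet> \<nabla>\<^sub>y\<L> \<beta> + \<Sum>\<^sub>i c\<^sub>i b\<^sub>i = 0\<close>; lower-level convexity makes the first term nonnegative, so every
  \<open>c\<^sub>i b\<^sub>i\<close> is zero. The abnormal C-multiplier is thus an M-multiplier, which \<open>A2m\<close>, upper-level
  regularity and \<open>A1m\<close> force to be zero.\<close>

section \<open>Gradients, Jacobians and adjoints tested against a direction\<close>

text \<open>Gradients, transposed Jacobians and adjoints encode derivatives in different ways.
  Vector equations between them are handled throughout by taking the inner product with an arbitrary
  direction \<open>d\<close>, which turns each into a value of the derivative.\<close>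

lemma grad_inner:
  assumes "(h has_derivative h') (at z)"
  shows "grad h z \<bullet> d = h' d"
proof -
  have lin: "linear h'" using assms has_derivative_linear by blast
  have fd: "frechet_derivative h (at z) = h'" using frechet_derivative_at[OF assms] by simp
  have "h' d = h' (\<Sum>i\<in>UNIV. d $ i *\<^sub>R axis i 1)"
    using basis_expansion[of d] by (simp add: scalar_mult_eq_scaleR)
  also have "\<dots> = (\<Sum>i\<in>UNIV. d $ i * h' (axis i 1))"
    using lin by (simp add: linear_sum linear_scale o_def)
  finally show ?thesis
    by (simp add: grad_def fd inner_vec_def mult.commute)
qed

text \<open>Phrased with \<open>v*\<close> because the simplifier rewrites
  \<open>transpose A *v v\<close> to \<open>v v* A\<close>.\<close>

lemma vector_matrix_jacobian_inner:
  fixes h :: "real ^ 'a \<Rightarrow> real ^ 'b"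
  assumes "(h has_derivative h') (at z)"
  shows "(v v* jacobian h (at z)) \<bullet> d = v \<bullet> h' d"
proof -
  have "h differentiable at z" using assms differentiable_def by blast
  then have "(h has_derivative (*v) (jacobian h (at z))) (at z)" by (simp add: jacobian_works)
  then have "h' = (*v) (jacobian h (at z))" using assms has_derivative_unique by blast
  then show ?thesis by (simp add: dot_lmul_matrix)
qed

lemma adjoint_frechet_inner:
  fixes h :: "'a::euclidean_space \<Rightarrow> 'b::euclidean_space"
  assumes "(h has_derivative h') (at z)"
  shows "adjoint (frechet_derivative h (at z)) v \<bullet> d = v \<bullet> h' d"
  using adjoint_works[OF has_derivative_linear[OF assms]] frechet_derivative_at[OF assms]
  by (simp add: inner_commute)

lemma has_derivative_partial_x:
  assumes "(h has_derivative h') (at (x, y))"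
  shows "((\<lambda>x'. h (x', y)) has_derivative (\<lambda>d. h' (d, 0))) (at x)"
proof -
  have "((\<lambda>x'. (x', y)) has_derivative (\<lambda>d. (d, 0))) (at x)"
    by (intro has_derivative_Pair has_derivative_ident has_derivative_const)
  from has_derivative_compose[OF this assms] show ?thesis .
qed

lemma has_derivative_partial_y:
  assumes "(h has_derivative h') (at (x, y))"
  shows "((\<lambda>y'. h (x, y')) has_derivative (\<lambda>d. h' (0, d))) (at y)"
proof -
  have "((\<lambda>y'. (x, y')) has_derivative (\<lambda>d. (0, d))) (at y)"
    by (intro has_derivative_Pair has_derivative_ident has_derivative_const)
  from has_derivative_compose[OF this assms] show ?thesis .
qed

lemma has_derivative_vec_nth:
  assumes "(h has_derivative h') F"
  shows "((\<lambda>z. h z $ i) has_derivative (\<lambda>d. h' d $ i)) F"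
  using bounded_linear.has_derivative[OF bounded_linear_vec_nth assms] .

text \<open>Collects the sum into one inner product: when \<open>w i\<close> is the gradient of the
  i-th component of a map, the vector on the right becomes the derivative of that map at
  \<open>d\<close>.\<close>

lemma sum_scaleR_inner:
  "(\<Sum>i\<in>UNIV. v $ i *\<^sub>R w i) \<bullet> d = v \<bullet> (\<chi> i. w i \<bullet> d)"
  by (simp add: inner_sum_left inner_vec_def[of v])

lemma eq_zero_if_inner_zero: "v = 0" if "\<And>d. v \<bullet> d = 0" for v :: "'a::real_inner"
  using that[of v] by simp

lemma inner_zero_if_eq_zero: "v \<bullet> d = 0" if "v = 0"
  using that by simp

section \<open>Excess, and convexity on the real line\<close>

text \<open>Turns the hypothesis on sets into one on an arbitrary selection: each term of the
  supremum is bounded by the excess, and an infimum below \<open>r\<close> is witnessed by a point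
  of \<open>B\<close>.\<close>

lemma excess_tendsto_0_imp_infdist_tendsto_0:
  assumes lim: "(\<lambda>k. excess (A k) B) \<longlonglongrightarrow> 0" and mem: "\<And>k. a k \<in> A k"
  shows "(\<lambda>k. infdist (a k) B) \<longlonglongrightarrow> 0"
proof (rule LIMSEQ_I)
  fix r :: real assume r: "r > 0"
  then have "\<forall>\<^sub>F k in sequentially. excess (A k) B < ennreal r"
    using lim by (intro order_tendstoD(2)) auto
  then have "\<forall>\<^sub>F k in sequentially. norm (infdist (a k) B - 0) < r"
  proof (rule eventually_mono)
    fix k assume *: "excess (A k) B < ennreal r"
    have "(INF b\<in>B. ennreal (norm (a k - b))) \<le> excess (A k) B"
      unfolding excess_def by (rule SUP_upper[OF mem])
    then have "(INF b\<in>B. ennreal (norm (a k - b))) < ennreal r" using * by (rule le_less_trans)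
    then obtain b where b: "b \<in> B" "ennreal (norm (a k - b)) < ennreal r"
      by (auto simp: INF_less_iff)
    then have "dist (a k) b < r" using r by (simp add: dist_norm ennreal_less_iff)
    then show "norm (infdist (a k) B - 0) < r"
      using infdist_le[OF b(1), of "a k"] infdist_nonneg[of "a k" B] by simp
  qed
  then show "\<exists>N. \<forall>k\<ge>N. norm (infdist (a k) B - 0) < r"
    by (simp add: eventually_sequentially)
qed

lemma convex_on_sum_of_functions:
  assumes "convex S" "\<And>i. i \<in> I \<Longrightarrow> convex_on S (h i)"
  shows "convex_on S (\<lambda>x. \<Sum>i\<in>I. h i x)"
  using assms(2)
proof (induction I rule: infinite_finite_induct)
  case (insert i I)
  then show ?case by (simp add: convex_on_add)
qed (auto simp: convex_on_const assms(1))

text \<open>Adding the tangent inequalities at \<open>a\<close> and at \<open>b\<close> shows that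
  \<open>k'\<close> is monotone, and the derivative of a monotone function is nonnegative.\<close>

lemma convex_imp_second_derivative_nonneg:
  fixes k k' :: "real \<Rightarrow> real"
  assumes conv: "convex_on UNIV k"
    and k: "\<And>s. (k has_real_derivative k' s) (at s)"
    and k': "(k' has_real_derivative D) (at s)"
  shows "D \<ge> 0"
proof -
  have tangent: "k b - k a \<ge> k' a * (b - a)" for a b
    using convex_on_imp_above_tangent[OF conv, of a b "k' a"] k[of a] by simp
  have "mono_on UNIV k'"
  proof (rule mono_onI)
    fix a b :: real assume "a \<le> b"
    show "k' a \<le> k' b"
    proof (cases "a = b")
      case False
      have "(k' b - k' a) * (b - a) \<ge> 0"
        using tangent[of a b] tangent[of b a] by (simp add: algebra_simps)
      then show ?thesis using False \<open>a \<le> b\<close> by (simp add: zero_le_mult_iff)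
    qed simp
  qed
  then show ?thesis using mono_on_imp_deriv_nonneg[OF _ k'] by simp
qed

section \<open>Derivatives of the data and of the lower-level Lagrangian gradient\<close>

text \<open>The total derivatives are fixed as maps into bounded linear functions, so their
  continuity is meant in operator norm. Partial derivatives are their values at
  \<open>(d, 0)\<close> and \<open>(0, d)\<close>.\<close>

locale C2_bilevel =
  fixes F f :: "(real ^ 'n) \<times> (real ^ 'm) \<Rightarrow> real"
    and G :: "real ^ 'n \<Rightarrow> real ^ 'p"
    and g :: "(real ^ 'n) \<times> (real ^ 'm) \<Rightarrow> real ^ 'q"
    and F' f' :: "(real ^ 'n) \<times> (real ^ 'm) \<Rightarrow> ((real ^ 'n) \<times> (real ^ 'm)) \<Rightarrow>\<^sub>L real"
    and G' :: "real ^ 'n \<Rightarrow> (real ^ 'n) \<Rightarrow>\<^sub>L (real ^ 'p)"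
    and g' :: "(real ^ 'n) \<times> (real ^ 'm) \<Rightarrow> ((real ^ 'n) \<times> (real ^ 'm)) \<Rightarrow>\<^sub>L (real ^ 'q)"
    and f'' :: "(real ^ 'n) \<times> (real ^ 'm) \<Rightarrow>
      ((real ^ 'n) \<times> (real ^ 'm)) \<Rightarrow>\<^sub>L ((real ^ 'n) \<times> (real ^ 'm)) \<Rightarrow>\<^sub>L real"
    and g'' :: "(real ^ 'n) \<times> (real ^ 'm) \<Rightarrow>
      ((real ^ 'n) \<times> (real ^ 'm)) \<Rightarrow>\<^sub>L ((real ^ 'n) \<times> (real ^ 'm)) \<Rightarrow>\<^sub>L (real ^ 'q)"
  assumes F: "\<And>z. (F has_derivative F' z) (at z)"
    and f: "\<And>z. (f has_derivative f' z) (at z)"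
    and G: "\<And>x. (G has_derivative G' x) (at x)"
    and g: "\<And>z. (g has_derivative g' z) (at z)"
    and f': "\<And>z. (f' has_derivative f'' z) (at z)"
    and g': "\<And>z. (g' has_derivative g'' z) (at z)"
    and cont_F': "\<And>z. isCont F' z"
    and cont_G': "\<And>x. isCont G' x"
    and cont_f'': "\<And>z. isCont f'' z"
    and cont_g'': "\<And>z. isCont g'' z"
begin

text \<open>The total derivative of \<open>Lag f g u\<close> in \<open>(x, y)\<close> for fixed
  \<open>u\<close>: component \<open>l\<close> is the second derivative of \<open>f\<close> plus
  \<open>u\<close> times \<open>g\<close>, first along \<open>d\<close> and then along the l-th unit
  vector of the \<open>y\<close>-space.\<close>

definition dLag :: "real ^ 'q \<Rightarrow> (real ^ 'n) \<times> (real ^ 'm) \<Rightarrow> (real ^ 'n) \<times> (real ^ 'm) \<Rightarrow> real ^ 'm" where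
  "dLag u z d = (\<chi> l. f'' z d (0, axis l 1) + u \<bullet> g'' z d (0, axis l 1))"

lemma grad_y_nth:
  assumes "(h has_derivative h') (at (x, y))"
  shows "grad_y h x y $ l = h' (0, axis l 1)"
  using grad_inner[OF has_derivative_partial_y[OF assms], of "axis l 1"]
  by (simp add: inner_axis)

lemma Lag_nth: "Lag f g u z $ l = f' z (0, axis l 1) + u \<bullet> g' z (0, axis l 1)"
proof (cases z)
  case (Pair x y)
  show ?thesis
    by (simp add: Pair Lag_def grad_y_nth[OF f] grad_y_nth[OF has_derivative_vec_nth[OF g]]
        inner_vec_def)
qed

lemma Lag_inner: "Lag f g u (x, y) \<bullet> d = f' (x, y) (0, d) + u \<bullet> g' (x, y) (0, d)"
  by (simp add: Lag_def inner_add_left sum_scaleR_inner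
      grad_inner[OF has_derivative_partial_y[OF f]]
      grad_inner[OF has_derivative_partial_y[OF has_derivative_vec_nth[OF g]]])

lemma has_derivative_Lag: "(Lag f g u has_derivative dLag u z) (at z)"
  unfolding has_derivative_componentwise_within[of "Lag f g u"]
proof
  fix b :: "real ^ 'm" assume "b \<in> Basis"
  then obtain l where b: "b = axis l 1" by (auto simp: Basis_vec_def)
  have "((\<lambda>z. f' z (0, axis l 1) + u \<bullet> g' z (0, axis l 1)) has_derivative
      (\<lambda>d. f'' z d (0, axis l 1) + u \<bullet> g'' z d (0, axis l 1))) (at z)"
    by (auto intro!: derivative_eq_intros f' g' simp: blinfun.bilinear_simps)
  then show "((\<lambda>x. Lag f g u x \<bullet> b) has_derivative (\<lambda>x. dLag u z x \<bullet> b)) (at z)"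
    by (simp add: b inner_axis Lag_nth dLag_def)
qed

lemma dyg_eq: "dyg g x y i \<beta> = g' (x, y) (0, \<beta>) $ i"
  using grad_inner[OF has_derivative_partial_y[OF has_derivative_vec_nth[OF g]], of x i y \<beta>]
  by (simp add: dyg_def inner_vec_def mult.commute)

text \<open>Rewrites every derivative expression in the stationarity notions and in
  \<open>A1m\<close>, \<open>A2m\<close> and \<open>upper_level_regular\<close>, once tested with a
  direction, to \<open>F'\<close>, \<open>G'\<close>, \<open>g'\<close> and
  \<open>dLag\<close>.\<close>

lemmas first_order_inner =
  grad_inner[OF has_derivative_partial_x[OF F]] grad_inner[OF has_derivative_partial_y[OF F]]
  grad_inner[OF has_derivative_vec_nth[OF G]]
  grad_inner[OF has_derivative_partial_x[OF has_derivative_vec_nth[OF g]]]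
  grad_inner[OF has_derivative_partial_y[OF has_derivative_vec_nth[OF g]]]
  grad_inner[OF has_derivative_partial_x[OF has_derivative_vec_nth[OF has_derivative_Lag]]]
  grad_inner[OF has_derivative_partial_y[OF has_derivative_vec_nth[OF has_derivative_Lag]]]
  vector_matrix_jacobian_inner[OF G]
  vector_matrix_jacobian_inner[OF has_derivative_partial_x[OF g]]
  vector_matrix_jacobian_inner[OF has_derivative_partial_y[OF g]]
  vector_matrix_jacobian_inner[OF has_derivative_partial_x[OF has_derivative_Lag]]
  vector_matrix_jacobian_inner[OF has_derivative_partial_y[OF has_derivative_Lag]]
  adjoint_frechet_inner[OF g] adjoint_frechet_inner[OF has_derivative_Lag]

text \<open>The last two conditions are the closed and homogeneous form of the sign conditions on the
  lower-level multipliers.\<close>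

definition fritz_john ::
    "real \<Rightarrow> real ^ 'n \<Rightarrow> real ^ 'm \<Rightarrow> real ^ 'q \<Rightarrow> real ^ 'p \<Rightarrow> real ^ 'm \<Rightarrow> real ^ 'q \<Rightarrow> bool" where
  "fritz_john r x y u \<alpha> \<beta> \<gamma> \<longleftrightarrow>
    (\<forall>d. r * F' (x, y) (d, 0) + \<alpha> \<bullet> G' x d + \<beta> \<bullet> dLag u (x, y) (d, 0) + \<gamma> \<bullet> g' (x, y) (d, 0) = 0) \<and>
    (\<forall>d. r * F' (x, y) (0, d) + \<beta> \<bullet> dLag u (x, y) (0, d) + \<gamma> \<bullet> g' (x, y) (0, d) = 0) \<and>
    (\<forall>j. \<alpha> $ j \<ge> 0 \<and> G x $ j \<le> 0 \<and> \<alpha> $ j * G x $ j = 0) \<and>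
    (\<forall>i. \<gamma> $ i * g' (x, y) (0, \<beta>) $ i \<ge> 0) \<and>
    (\<forall>i. g' (x, y) (0, \<beta>) $ i * u $ i + \<gamma> $ i * g (x, y) $ i = 0)"

section \<open>The Fritz John system: homogeneity and closedness\<close>

text \<open>The equations are linear in \<open>(r, \<alpha>, \<beta>, \<gamma>)\<close> and the
  products \<open>\<gamma> $ i * g' (x, y) (0, \<beta>) $ i\<close> scale with the square of
  \<open>c\<close>. This serves both to normalise the multipliers and, after the limit, to bring the
  objective factor back to 1.\<close>

lemma fritz_john_scaleR:
  assumes "fritz_john r x y u \<alpha> \<beta> \<gamma>" and "c \<ge> 0"
  shows "fritz_john (c * r) x y u (c *\<^sub>R \<alpha>) (c *\<^sub>R \<beta>) (c *\<^sub>R \<gamma>)"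
proof -
  have lin: "g' (x, y) (0, c *\<^sub>R \<beta>) = c *\<^sub>R g' (x, y) (0, \<beta>)"
    by (metis blinfun.scaleR_right scaleR_Pair scaleR_zero_right)
  have 1: "c * r * F' (x, y) (d, 0) + c * (\<alpha> \<bullet> G' x d) + c * (\<beta> \<bullet> dLag u (x, y) (d, 0))
      + c * (\<gamma> \<bullet> g' (x, y) (d, 0)) = 0" for d
  proof -
    have "c * (r * F' (x, y) (d, 0) + \<alpha> \<bullet> G' x d + \<beta> \<bullet> dLag u (x, y) (d, 0)
      + \<gamma> \<bullet> g' (x, y) (d, 0)) = 0" using assms(1) by (simp add: fritz_john_def)
    then show ?thesis by (simp add: algebra_simps)
  qed
  have 2: "c * r * F' (x, y) (0, d) + c * (\<beta> \<bullet> dLag u (x, y) (0, d))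
      + c * (\<gamma> \<bullet> g' (x, y) (0, d)) = 0" for d
  proof -
    have "c * (r * F' (x, y) (0, d) + \<beta> \<bullet> dLag u (x, y) (0, d) + \<gamma> \<bullet> g' (x, y) (0, d)) = 0"
      using assms(1) by (simp add: fritz_john_def)
    then show ?thesis by (simp add: algebra_simps)
  qed
  have 3: "c * g' (x, y) (0, \<beta>) $ i * u $ i + c * \<gamma> $ i * g (x, y) $ i = 0" for i
  proof -
    have "c * (g' (x, y) (0, \<beta>) $ i * u $ i + \<gamma> $ i * g (x, y) $ i) = 0"
      using assms(1) by (simp add: fritz_john_def)
    then show ?thesis by (simp add: algebra_simps)
  qed
  have 4: "c * \<gamma> $ i * (c * g' (x, y) (0, \<beta>) $ i) \<ge> 0" for i
  proof -
    have "c * c * (\<gamma> $ i * g' (x, y) (0, \<beta>) $ i) \<ge> 0"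
      using assms by (simp add: fritz_john_def)
    then show ?thesis by (simp add: algebra_simps)
  qed
  show ?thesis
    using assms 1 2 3 4 unfolding fritz_john_def lin by simp
qed

text \<open>Every condition is an equation or a weak inequality between continuous expressions. None
  refers to the index sets, which may change in the limit.\<close>

lemma fritz_john_closed:
  assumes fj: "\<And>k. fritz_john (r k) (x k) (y k) (u k) (\<alpha> k) (\<beta> k) (\<gamma> k)"
    and lims: "r \<longlonglongrightarrow> r0" "x \<longlonglongrightarrow> x0" "y \<longlonglongrightarrow> y0" "u \<longlonglongrightarrow> u0" "\<alpha> \<longlonglongrightarrow> \<alpha>0" "\<beta> \<longlonglongrightarrow> \<beta>0" "\<gamma> \<longlonglongrightarrow> \<gamma>0"
  shows "fritz_john r0 x0 y0 u0 \<alpha>0 \<beta>0 \<gamma>0"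
proof -
  have z: "(\<lambda>k. (x k, y k)) \<longlonglongrightarrow> (x0, y0)" using lims by (intro tendsto_Pair)
  note [tendsto_intros] = lims
    isCont_tendsto_compose[OF cont_F' z] isCont_tendsto_compose[OF cont_G' lims(2)]
    isCont_tendsto_compose[OF cont_f'' z] isCont_tendsto_compose[OF cont_g'' z]
    isCont_tendsto_compose[OF has_derivative_continuous[OF g'] z]
    isCont_tendsto_compose[OF has_derivative_continuous[OF g] z]
    isCont_tendsto_compose[OF has_derivative_continuous[OF G] lims(2)]
  have dLag: "(\<lambda>k. dLag (u k) (x k, y k) d) \<longlonglongrightarrow> dLag u0 (x0, y0) d" for d
    unfolding dLag_def by (intro tendsto_intros)
  note [tendsto_intros] = dLag
  have limI: "c = c0" if "(\<lambda>k. s k) \<longlonglongrightarrow> c" "\<And>k. s k = c0" for s and c c0 :: real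
    using that LIMSEQ_unique[OF that(1), of c0] by simp
  have "r0 * F' (x0, y0) (d, 0) + \<alpha>0 \<bullet> G' x0 d + \<beta>0 \<bullet> dLag u0 (x0, y0) (d, 0)
      + \<gamma>0 \<bullet> g' (x0, y0) (d, 0) = 0" for d
  proof (rule limI)
    show "(\<lambda>k. r k * F' (x k, y k) (d, 0) + \<alpha> k \<bullet> G' (x k) d + \<beta> k \<bullet> dLag (u k) (x k, y k) (d, 0)
        + \<gamma> k \<bullet> g' (x k, y k) (d, 0)) \<longlonglongrightarrow> r0 * F' (x0, y0) (d, 0) + \<alpha>0 \<bullet> G' x0 d
        + \<beta>0 \<bullet> dLag u0 (x0, y0) (d, 0) + \<gamma>0 \<bullet> g' (x0, y0) (d, 0)"
      by (intro tendsto_intros)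
  qed (use fj in \<open>simp add: fritz_john_def\<close>)
  moreover have "r0 * F' (x0, y0) (0, d) + \<beta>0 \<bullet> dLag u0 (x0, y0) (0, d)
      + \<gamma>0 \<bullet> g' (x0, y0) (0, d) = 0" for d
  proof (rule limI)
    show "(\<lambda>k. r k * F' (x k, y k) (0, d) + \<beta> k \<bullet> dLag (u k) (x k, y k) (0, d)
        + \<gamma> k \<bullet> g' (x k, y k) (0, d)) \<longlonglongrightarrow> r0 * F' (x0, y0) (0, d)
        + \<beta>0 \<bullet> dLag u0 (x0, y0) (0, d) + \<gamma>0 \<bullet> g' (x0, y0) (0, d)"
      by (intro tendsto_intros)
  qed (use fj in \<open>simp add: fritz_john_def\<close>)
  moreover have "\<alpha>0 $ j \<ge> 0" for j
    by (rule tendsto_lowerbound[where f = "\<lambda>k. \<alpha> k $ j" and F = sequentially])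
      (use fj in \<open>auto simp: fritz_john_def intro: tendsto_intros\<close>)
  moreover have "G x0 $ j \<le> 0" for j
    by (rule tendsto_upperbound[where f = "\<lambda>k. G (x k) $ j" and F = sequentially])
      (use fj in \<open>auto simp: fritz_john_def intro: tendsto_intros\<close>)
  moreover have "\<alpha>0 $ j * G x0 $ j = 0" for j
  proof (rule limI)
    show "(\<lambda>k. \<alpha> k $ j * G (x k) $ j) \<longlonglongrightarrow> \<alpha>0 $ j * G x0 $ j" by (intro tendsto_intros)
  qed (use fj in \<open>simp add: fritz_john_def\<close>)
  moreover have "\<gamma>0 $ i * g' (x0, y0) (0, \<beta>0) $ i \<ge> 0" for i
  proof (rule tendsto_lowerbound)
    show "(\<lambda>k. \<gamma> k $ i * g' (x k, y k) (0, \<beta> k) $ i) \<longlonglongrightarrow> \<gamma>0 $ i * g' (x0, y0) (0, \<beta>0) $ i"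
      by (intro tendsto_intros)
  qed (use fj in \<open>auto simp: fritz_john_def\<close>)
  moreover have "g' (x0, y0) (0, \<beta>0) $ i * u0 $ i + \<gamma>0 $ i * g (x0, y0) $ i = 0" for i
  proof (rule limI)
    show "(\<lambda>k. g' (x k, y k) (0, \<beta> k) $ i * u k $ i + \<gamma> k $ i * g (x k, y k) $ i)
        \<longlonglongrightarrow> g' (x0, y0) (0, \<beta>0) $ i * u0 $ i + \<gamma>0 $ i * g (x0, y0) $ i"
      by (intro tendsto_intros)
  qed (use fj in \<open>simp add: fritz_john_def\<close>)
  ultimately show ?thesis by (simp add: fritz_john_def)
qed

section \<open>From relaxed stationarity to Fritz John, and from Fritz John to
  C-stationarity\<close>

lemma fritz_john_if_relaxed_stationary:
  assumes st: "relaxed_stationary F f G g t x" and t: "t > 0"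
  shows "\<exists>y u \<alpha> \<beta> \<gamma>. (y, u) \<in> S_p_relaxed F f g t x \<and> fritz_john 1 x y u \<alpha> \<beta> \<gamma>"
proof -
  obtain y u \<alpha> \<beta> \<gamma> \<mu> \<delta> where
      S: "(y, u) \<in> S_p_relaxed F f g t x"
    and X: "grad_x F x y + transpose (jacobian G (at x)) *v \<alpha> + transpose (Jac_x (Lag f g u) x y) *v \<beta>
        - (\<Sum>i\<in>UNIV. (\<gamma> $ i - \<delta> $ i * u $ i) *\<^sub>R grad_x (\<lambda>z. g z $ i) x y) = 0"
    and Y: "grad_y F x y + transpose (Jac_y (Lag f g u) x y) *v \<beta>
        - (\<Sum>i\<in>UNIV. (\<gamma> $ i - \<delta> $ i * u $ i) *\<^sub>R grad_y (\<lambda>z. g z $ i) x y) = 0"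
    and U: "\<forall>i. dyg g x y i \<beta> + \<mu> $ i + \<delta> $ i * g (x, y) $ i = 0"
    and A: "\<forall>j. \<alpha> $ j \<ge> 0 \<and> G x $ j \<le> 0 \<and> \<alpha> $ j * G x $ j = 0"
    and C: "\<forall>i. \<gamma> $ i \<ge> 0 \<and> g (x, y) $ i \<le> 0 \<and> \<gamma> $ i * g (x, y) $ i = 0"
    and M: "\<forall>i. \<mu> $ i \<ge> 0 \<and> u $ i \<ge> 0 \<and> \<mu> $ i * u $ i = 0"
    and D: "\<forall>i. \<delta> $ i \<ge> 0 \<and> - (u $ i * g (x, y) $ i) \<le> t \<and> \<delta> $ i * (u $ i * g (x, y) $ i + t) = 0"
    using st unfolding relaxed_stationary_def by blast
  \<comment> \<open>The opposite of the bracket in the relaxed system, since C-stationarity adds the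
    term that relaxed stationarity subtracts.\<close>
  define c where "c = (\<chi> i. \<delta> $ i * u $ i - \<gamma> $ i)"
  have flip: "a - (\<Sum>i\<in>UNIV. (\<gamma> $ i - \<delta> $ i * u $ i) *\<^sub>R w i) = a + (\<Sum>i\<in>UNIV. c $ i *\<^sub>R w i)"
    for a and w :: "'q \<Rightarrow> 'v::real_vector"
    by (simp add: c_def algebra_simps sum_subtractf)
  have CM: "\<gamma> $ i * g (x, y) $ i = 0" "\<mu> $ i * u $ i = 0" for i
    using C M by blast+
  have b: "g' (x, y) (0, \<beta>) $ i = - \<mu> $ i - \<delta> $ i * g (x, y) $ i" for i
    using U[rule_format, of i] by (simp add: dyg_eq)
  have "1 * F' (x, y) (d, 0) + \<alpha> \<bullet> G' x d + \<beta> \<bullet> dLag u (x, y) (d, 0) + c \<bullet> g' (x, y) (d, 0) = 0" for d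
    using inner_zero_if_eq_zero[OF X[unfolded flip], of d]
    by (simp add: inner_add_left sum_scaleR_inner first_order_inner)
  moreover have "1 * F' (x, y) (0, d) + \<beta> \<bullet> dLag u (x, y) (0, d) + c \<bullet> g' (x, y) (0, d) = 0" for d
    using inner_zero_if_eq_zero[OF Y[unfolded flip], of d]
    by (simp add: inner_add_left sum_scaleR_inner first_order_inner)
  moreover have "c $ i * g' (x, y) (0, \<beta>) $ i \<ge> 0" for i
  proof -
    \<comment> \<open>A nonzero \<open>\<delta> $ i\<close> forces the relaxed complementarity
      constraint to be active, so \<open>u $ i * g (x, y) $ i\<close> may be replaced by
      \<open>- t\<close>. This turns the one term of unclear sign into the square of
      \<open>\<delta> $ i\<close> times \<open>t\<close>.\<close>
    have e: "\<delta> $ i * (u $ i * g (x, y) $ i) = - (\<delta> $ i * t)"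
      using D[rule_format, of i] by (simp add: algebra_simps)
    have "c $ i * g' (x, y) (0, \<beta>) $ i = - \<delta> $ i * (\<mu> $ i * u $ i)
        - \<delta> $ i * (\<delta> $ i * (u $ i * g (x, y) $ i)) + \<gamma> $ i * \<mu> $ i + \<delta> $ i * (\<gamma> $ i * g (x, y) $ i)"
      by (simp add: b c_def algebra_simps)
    also have "\<dots> = \<delta> $ i * \<delta> $ i * t + \<gamma> $ i * \<mu> $ i"
      unfolding e CM by (simp add: algebra_simps)
    also have "\<dots> \<ge> 0" using C M t by simp
    finally show ?thesis .
  qed
  moreover have "g' (x, y) (0, \<beta>) $ i * u $ i + c $ i * g (x, y) $ i = 0" for i
  proof -
    \<comment> \<open>The two terms with \<open>\<delta> $ i * u $ i * g (x, y) $ i\<close> cancel,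
      and complementarity of \<open>\<mu>\<close> and \<open>\<gamma>\<close> removes the
      rest.\<close>
    have "g' (x, y) (0, \<beta>) $ i * u $ i + c $ i * g (x, y) $ i = - (\<mu> $ i * u $ i) - \<gamma> $ i * g (x, y) $ i"
      unfolding b c_def by (simp add: algebra_simps)
    then show ?thesis unfolding CM by simp
  qed
  ultimately have "fritz_john 1 x y u \<alpha> \<beta> c" using A by (simp add: fritz_john_def)
  then show ?thesis using S by blast
qed

text \<open>The last condition of \<open>fritz_john\<close> yields both index set conditions: on
  \<open>idx_nu\<close> the second summand vanishes and \<open>u $ i > 0\<close>, on
  \<open>idx_eta\<close> the first vanishes and \<open>g (x, y) $ i < 0\<close>.\<close>

lemma C_stationary_if_fritz_john:
  assumes fj: "fritz_john 1 x y u \<alpha> \<beta> \<gamma>" and S: "(y, u) \<in> S_p F f g x"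
  shows "C_stationary F f G g x"
  unfolding C_stationary_def
proof (intro exI conjI)
  show "grad_x F x y + (\<Sum>j\<in>UNIV. \<alpha> $ j *\<^sub>R grad (\<lambda>x'. G x' $ j) x)
        + (\<Sum>l\<in>UNIV. \<beta> $ l *\<^sub>R grad_x (\<lambda>z. Lag f g u z $ l) x y)
        + (\<Sum>i\<in>UNIV. \<gamma> $ i *\<^sub>R grad_x (\<lambda>z. g z $ i) x y) = 0"
    by (rule eq_zero_if_inner_zero)
      (use fj in \<open>simp add: fritz_john_def inner_add_left sum_scaleR_inner first_order_inner\<close>)
  show "grad_y F x y
        + (\<Sum>l\<in>UNIV. \<beta> $ l *\<^sub>R grad_y (\<lambda>z. Lag f g u z $ l) x y)
        + (\<Sum>i\<in>UNIV. \<gamma> $ i *\<^sub>R grad_y (\<lambda>z. g z $ i) x y) = 0"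
    by (rule eq_zero_if_inner_zero)
      (use fj in \<open>simp add: fritz_john_def inner_add_left sum_scaleR_inner first_order_inner\<close>)
  show "\<forall>j. \<alpha> $ j \<ge> 0 \<and> G x $ j \<le> 0 \<and> \<alpha> $ j * G x $ j = 0"
    using fj by (simp add: fritz_john_def)
  have eq: "g' (x, y) (0, \<beta>) $ i * u $ i + \<gamma> $ i * g (x, y) $ i = 0" for i
    using fj by (simp add: fritz_john_def)
  show "\<forall>i\<in>idx_nu g x y u. dyg g x y i \<beta> = 0"
  proof
    fix i assume "i \<in> idx_nu g x y u"
    then show "dyg g x y i \<beta> = 0" using eq[of i] by (simp add: dyg_eq idx_nu_def)
  qed
  show "\<forall>i\<in>idx_eta g x y u. \<gamma> $ i = 0"
  proof
    fix i assume "i \<in> idx_eta g x y u"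
    then show "\<gamma> $ i = 0" using eq[of i] by (simp add: idx_eta_def)
  qed
  show "\<forall>i\<in>idx_theta g x y u. \<gamma> $ i * dyg g x y i \<beta> \<ge> 0"
    using fj by (simp add: fritz_john_def dyg_eq)
qed (fact S)

section \<open>Lower-level convexity and abnormal multipliers\<close>

text \<open>For \<open>u \<ge> 0\<close> the lower-level Lagrangian is convex in \<open>y\<close>
  and has gradient \<open>Lag f g u\<close>, so the expression is its Hessian quadratic form. It is
  computed as the second derivative at 0 of the restriction to the line through \<open>y\<close>
  with direction \<open>\<beta>\<close>.\<close>

lemma dLag_y_psd:
  assumes convex_f: "convex_on UNIV (\<lambda>y. f (x, y))"
    and convex_g: "\<And>i. convex_on UNIV (\<lambda>y. g (x, y) $ i)"
    and u: "0 \<le> u"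
  shows "\<beta> \<bullet> dLag u (x, y) (0, \<beta>) \<ge> 0"
proof -
  let ?y = "\<lambda>s. y + s *\<^sub>R \<beta>"
  have line: "(?y has_derivative (\<lambda>d. d *\<^sub>R \<beta>)) (at s)" for s
    by (auto intro!: derivative_eq_intros)
  define h where "h y = f (x, y) + u \<bullet> g (x, y)" for y
  have "convex_on UNIV (\<lambda>y. u $ i * g (x, y) $ i)" for i
    using u by (intro convex_on_cmul convex_g) (simp add: less_eq_vec_def)
  then have "convex_on UNIV (\<lambda>y. \<Sum>i\<in>UNIV. u $ i * g (x, y) $ i)"
    by (intro convex_on_sum_of_functions) auto
  from convex_on_add[OF convex_f this] have "convex_on UNIV h"
    by (simp add: h_def[abs_def] inner_vec_def)
  have conv: "convex_on UNIV (\<lambda>s. h (?y s))"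
  proof (rule convex_onI)
    fix r a b :: real assume r: "0 < r" "r < 1"
    have "?y ((1 - r) *\<^sub>R a + r *\<^sub>R b) = (1 - r) *\<^sub>R ?y a + r *\<^sub>R ?y b"
      by (simp add: algebra_simps)
    then show "h (?y ((1 - r) *\<^sub>R a + r *\<^sub>R b)) \<le> (1 - r) * h (?y a) + r * h (?y b)"
      using convex_onD[OF \<open>convex_on UNIV h\<close>, of r "?y a" "?y b"] r by simp
  qed simp
  have deriv: "((\<lambda>s. h (?y s)) has_real_derivative \<beta> \<bullet> Lag f g u (x, ?y s)) (at s)" for s
  proof -
    have "(h has_derivative (\<lambda>d. f' (x, ?y s) (0, d) + u \<bullet> g' (x, ?y s) (0, d))) (at (?y s))"
      unfolding h_def
      by (auto intro!: derivative_eq_intros has_derivative_partial_y[OF f] has_derivative_partial_y[OF g])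
    then have "(h has_derivative (\<lambda>d. Lag f g u (x, ?y s) \<bullet> d)) (at (?y s))"
      by (simp add: Lag_inner)
    from has_derivative_compose[OF line this] show ?thesis
      by (simp add: has_field_derivative_def inner_commute mult_commute_abs)
  qed
  have "((\<lambda>s. \<beta> \<bullet> Lag f g u (x, ?y s)) has_real_derivative \<beta> \<bullet> dLag u (x, y) (0, \<beta>)) (at 0)"
  proof -
    have "((\<lambda>y. Lag f g u (x, y)) has_derivative (\<lambda>d. dLag u (x, y) (0, d))) (at (?y 0))"
      using has_derivative_partial_y[OF has_derivative_Lag] by simp
    from has_derivative_compose[OF line this]
    have "((\<lambda>s. Lag f g u (x, ?y s)) has_derivative (\<lambda>d. dLag u (x, y) (0, d *\<^sub>R \<beta>))) (at 0)" .
    moreover have "dLag u (x, y) (0, d *\<^sub>R \<beta>) = d *\<^sub>R dLag u (x, y) (0, \<beta>)" for d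
      using linear_scale[OF has_derivative_linear[OF has_derivative_Lag[of u "(x, y)"]], of d "(0, \<beta>)"]
      by simp
    ultimately show ?thesis
      by (auto simp: has_field_derivative_def mult_commute_abs intro!: derivative_eq_intros)
  qed
  with convex_imp_second_derivative_nonneg[OF conv deriv] show ?thesis .
qed

lemma fritz_john_abnormal_trivial:
  assumes fj: "fritz_john 0 x y u \<alpha> \<beta> \<gamma>"
    and convex_f: "convex_on UNIV (\<lambda>y. f (x, y))"
    and convex_g: "\<And>i. convex_on UNIV (\<lambda>y. g (x, y) $ i)"
    and u: "0 \<le> u"
    and regular: "upper_level_regular G x"
    and A1: "A1m f g x y u" and A2: "A2m f g x y u"
  shows "\<alpha> = 0 \<and> \<beta> = 0 \<and> \<gamma> = 0"
proof -
  have X: "\<alpha> \<bullet> G' x d + \<beta> \<bullet> dLag u (x, y) (d, 0) + \<gamma> \<bullet> g' (x, y) (d, 0) = 0" for d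
    using fj by (simp add: fritz_john_def)
  have Y: "\<beta> \<bullet> dLag u (x, y) (0, d) + \<gamma> \<bullet> g' (x, y) (0, d) = 0" for d
    using fj by (simp add: fritz_john_def)
  have prod: "\<gamma> $ i * g' (x, y) (0, \<beta>) $ i \<ge> 0" for i
    using fj by (simp add: fritz_john_def)
  have eq: "g' (x, y) (0, \<beta>) $ i * u $ i + \<gamma> $ i * g (x, y) $ i = 0" for i
    using fj by (simp add: fritz_john_def)
  \<comment> \<open>The \<open>y\<close>-equation tested with \<open>\<beta>\<close> itself; the sum
    equals minus the Hessian form.\<close>
  have "(\<Sum>i\<in>UNIV. \<gamma> $ i * g' (x, y) (0, \<beta>) $ i) \<le> 0"
    using Y[of \<beta>] dLag_y_psd[OF convex_f convex_g u, of \<beta> y] by (simp add: inner_vec_def[of \<gamma>])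
  then have zero: "\<gamma> $ i * g' (x, y) (0, \<beta>) $ i = 0" for i
    using prod by (metis (no_types, lifting) UNIV_I finite sum_nonneg sum_nonneg_eq_0_iff order_antisym)
  \<comment> \<open>On \<open>idx_theta\<close> it is always the second alternative of the
    M-condition that holds, by \<open>zero\<close>.\<close>
  have sign: "M_sign g x y u \<beta> \<gamma>"
    unfolding M_sign_def
  proof (intro conjI ballI)
    fix i assume "i \<in> idx_nu g x y u"
    then show "dyg g x y i \<beta> = 0" using eq[of i] by (simp add: dyg_eq idx_nu_def)
  next
    fix i assume "i \<in> idx_eta g x y u"
    then show "\<gamma> $ i = 0" using eq[of i] by (simp add: idx_eta_def)
  qed (use zero in \<open>simp add: dyg_eq\<close>)
  have "transpose (Jac_y (Lag f g u) x y) *v \<beta> + transpose (Jac_y g x y) *v \<gamma> = 0"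
    by (rule eq_zero_if_inner_zero) (use Y in \<open>simp add: inner_add_left first_order_inner\<close>)
  with sign A2 have "transpose (Jac_x (Lag f g u) x y) *v \<beta> + transpose (Jac_x g x y) *v \<gamma> = 0"
    unfolding A2m_def Lambda_em_y_def by blast
  from inner_zero_if_eq_zero[OF this]
  have X0: "\<beta> \<bullet> dLag u (x, y) (d, 0) + \<gamma> \<bullet> g' (x, y) (d, 0) = 0" for d
    by (simp add: inner_add_left first_order_inner)
  \<comment> \<open>What \<open>A2m\<close> gave cancels the lower-level terms of the
    \<open>x\<close>-equation, which leaves a condition on \<open>\<alpha>\<close> alone for
    upper-level regularity.\<close>
  have \<alpha>0: "\<alpha> \<bullet> G' x d = 0" for d
    using X[of d] X0[of d] by linarith
  have "transpose (jacobian G (at x)) *v \<alpha> = 0"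
    by (rule eq_zero_if_inner_zero) (use \<alpha>0 in \<open>simp add: first_order_inner\<close>)
  moreover have "0 \<le> \<alpha>" using fj by (simp add: fritz_john_def less_eq_vec_def)
  moreover have "\<alpha> \<bullet> G x = 0"
    unfolding inner_vec_def by (rule sum.neutral) (use fj in \<open>simp add: fritz_john_def\<close>)
  ultimately have \<alpha>: "\<alpha> = 0" using regular unfolding upper_level_regular_def by blast
  \<comment> \<open>The partial equations in \<open>x\<close> and \<open>y\<close> are joined by
    linearity, because \<open>A1m\<close> speaks of the derivative in the joint variable.\<close>
  have XY: "\<beta> \<bullet> dLag u (x, y) d + \<gamma> \<bullet> g' (x, y) d = 0" for d
  proof -
    have "dLag u (x, y) d = dLag u (x, y) (fst d, 0) + dLag u (x, y) (0, snd d)"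
      using linear_add[OF has_derivative_linear[OF has_derivative_Lag[of u "(x, y)"]],
        of "(fst d, 0)" "(0, snd d)"] by simp
    moreover have "g' (x, y) d = g' (x, y) (fst d, 0) + g' (x, y) (0, snd d)"
      using blinfun.add_right[of "g' (x, y)" "(fst d, 0)" "(0, snd d)"] by simp
    ultimately show ?thesis
      using X0[of "fst d"] Y[of "snd d"] by (simp add: inner_add_right)
  qed
  have "Jac_xy_transpose (Lag f g u) x y \<beta> + Jac_xy_transpose g x y \<gamma> = 0"
    by (rule eq_zero_if_inner_zero) (use XY in \<open>simp add: inner_add_left first_order_inner\<close>)
  with sign A1 have "\<beta> = 0 \<and> \<gamma> = 0"
    unfolding A1m_def Lambda_em_def by blast
  with \<alpha> show ?thesis by simp
qed

section \<open>Passage to the limit\<close>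

lemma C_stationary_limit:
  assumes convex_f: "\<And>x. convex_on UNIV (\<lambda>y. f (x, y))"
    and convex_g: "\<And>x i. convex_on UNIV (\<lambda>y. g (x, y) $ i)"
    and t_pos: "\<And>k. t k > 0"
    and stationary: "\<And>k. relaxed_stationary F f G g (t k) (xs k)"
    and xs_lim: "xs \<longlonglongrightarrow> xbar"
    and S_p_xbar: "S_p F f g xbar \<noteq> {}" "compact (S_p F f g xbar)"
    and upper_regular: "upper_level_regular G xbar"
    and A1: "\<And>y u. (y, u) \<in> S_p F f g xbar \<Longrightarrow> A1m f g xbar y u"
    and A2: "\<And>y u. (y, u) \<in> S_p F f g xbar \<Longrightarrow> A2m f g xbar y u"
    and excess_lim: "(\<lambda>k. excess (S_p_relaxed F f g (t k) (xs k)) (S_p F f g xbar)) \<longlonglongrightarrow> 0"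
  shows "C_stationary F f G g xbar"
proof -
  let ?S = "S_p F f g xbar"
  have "\<forall>k. \<exists>y u \<alpha> \<beta> \<gamma>. (y, u) \<in> S_p_relaxed F f g (t k) (xs k) \<and> fritz_john 1 (xs k) y u \<alpha> \<beta> \<gamma>"
    using fritz_john_if_relaxed_stationary stationary t_pos by blast
  then obtain y u \<alpha> \<beta> \<gamma> where
      S: "\<And>k. (y k, u k) \<in> S_p_relaxed F f g (t k) (xs k)"
    and fj: "\<And>k. fritz_john 1 (xs k) (y k) (u k) (\<alpha> k) (\<beta> k) (\<gamma> k)"
    by metis
  have dist0: "(\<lambda>k. infdist (y k, u k) ?S) \<longlonglongrightarrow> 0"
    by (rule excess_tendsto_0_imp_infdist_tendsto_0[OF excess_lim S])
  \<comment> \<open>The pairs \<open>(y k, u k)\<close> themselves need not lie in the compact set,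
    so compactness is applied to their nearest points in it.\<close>
  have "\<forall>k. \<exists>b\<in>?S. infdist (y k, u k) ?S = dist (y k, u k) b"
    using infdist_attains_inf[OF compact_imp_closed[OF S_p_xbar(2)] S_p_xbar(1)] by metis
  then obtain b where b: "\<And>k. b k \<in> ?S" "\<And>k. infdist (y k, u k) ?S = dist (y k, u k) (b k)"
    by metis
  \<comment> \<open>The entry 1 is the factor of the objective. It keeps \<open>w k\<close> away
    from zero, and its normalised limit \<open>r0\<close> decides between the normal and the
    abnormal case.\<close>
  define w where "w k = (1::real, \<alpha> k, \<beta> k, \<gamma> k)" for k
  have w_pos: "norm (w k) > 0" for k by (simp add: w_def zero_prod_def)
  define v where "v k = w k /\<^sub>R norm (w k)" for k
  have norm_v: "norm (v k) = 1" for k using w_pos[of k] by (simp add: v_def)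
  \<comment> \<open>One product set, so that nearest points and normalised multipliers converge
    along a common subsequence.\<close>
  have "compact (?S \<times> sphere (0 :: real \<times> (real ^ 'p) \<times> (real ^ 'm) \<times> (real ^ 'q)) 1)"
    using S_p_xbar(2) by (intro compact_Times) auto
  moreover have "\<forall>k. (b k, v k) \<in> ?S \<times> sphere 0 1" using b(1) norm_v by simp
  ultimately obtain l \<sigma> where l: "l \<in> ?S \<times> sphere 0 1"
    and \<sigma>: "strict_mono (\<sigma> :: nat \<Rightarrow> nat)" "((\<lambda>k. (b k, v k)) \<circ> \<sigma>) \<longlonglongrightarrow> l"
    by (rule seq_compactE[OF compact_imp_seq_compact])
  obtain y0 u0 r0 \<alpha>0 \<beta>0 \<gamma>0 where l_def: "l = ((y0, u0), (r0, \<alpha>0, \<beta>0, \<gamma>0))"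
    by (metis surj_pair)
  have S0: "(y0, u0) \<in> ?S" and norm0: "norm (r0, \<alpha>0, \<beta>0, \<gamma>0) = 1" using l by (auto simp: l_def)
  have b_lim: "(\<lambda>k. b (\<sigma> k)) \<longlonglongrightarrow> (y0, u0)" and v_lim: "(\<lambda>k. v (\<sigma> k)) \<longlonglongrightarrow> (r0, \<alpha>0, \<beta>0, \<gamma>0)"
    using tendsto_fst[OF \<sigma>(2)] tendsto_snd[OF \<sigma>(2)] by (simp_all add: l_def o_def)
  have "(\<lambda>k. dist (y (\<sigma> k), u (\<sigma> k)) (b (\<sigma> k))) \<longlonglongrightarrow> 0"
    using LIMSEQ_subseq_LIMSEQ[OF dist0 \<sigma>(1)] by (simp add: b(2) o_def)
  then have "(\<lambda>k. (y (\<sigma> k), u (\<sigma> k))) \<longlonglongrightarrow> (y0, u0)"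
    using b_lim Lim_transform[OF b_lim] by (simp add: dist_norm tendsto_norm_zero_iff)
  then have yu: "(\<lambda>k. y (\<sigma> k)) \<longlonglongrightarrow> y0" "(\<lambda>k. u (\<sigma> k)) \<longlonglongrightarrow> u0"
    using tendsto_fst tendsto_snd by fastforce+
  have x: "(\<lambda>k. xs (\<sigma> k)) \<longlonglongrightarrow> xbar"
    using LIMSEQ_subseq_LIMSEQ[OF xs_lim \<sigma>(1)] by (simp add: o_def)
  define c where "c k = inverse (norm (w (\<sigma> k)))" for k
  have v: "v (\<sigma> k) = (c k, c k *\<^sub>R \<alpha> (\<sigma> k), c k *\<^sub>R \<beta> (\<sigma> k), c k *\<^sub>R \<gamma> (\<sigma> k))" for k
    by (simp add: v_def w_def c_def)
  have lims: "c \<longlonglongrightarrow> r0" "(\<lambda>k. c k *\<^sub>R \<alpha> (\<sigma> k)) \<longlonglongrightarrow> \<alpha>0" "(\<lambda>k. c k *\<^sub>R \<beta> (\<sigma> k)) \<longlonglongrightarrow> \<beta>0"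
      "(\<lambda>k. c k *\<^sub>R \<gamma> (\<sigma> k)) \<longlonglongrightarrow> \<gamma>0"
    using v_lim[THEN tendsto_fst] v_lim[THEN tendsto_snd, THEN tendsto_fst]
      v_lim[THEN tendsto_snd, THEN tendsto_snd, THEN tendsto_fst]
      v_lim[THEN tendsto_snd, THEN tendsto_snd, THEN tendsto_snd]
    by (simp_all add: v)
  have c_nonneg: "c k \<ge> 0" for k by (simp add: c_def)
  have "fritz_john (c k) (xs (\<sigma> k)) (y (\<sigma> k)) (u (\<sigma> k)) (c k *\<^sub>R \<alpha> (\<sigma> k)) (c k *\<^sub>R \<beta> (\<sigma> k))
      (c k *\<^sub>R \<gamma> (\<sigma> k))" for k
    using fritz_john_scaleR[OF fj c_nonneg] by simp
  from fritz_john_closed[OF this lims(1) x yu lims(2-4)]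
  have fj0: "fritz_john r0 xbar y0 u0 \<alpha>0 \<beta>0 \<gamma>0" .
  have r0: "r0 \<ge> 0" using LIMSEQ_le_const[OF lims(1)] c_nonneg by blast
  \<comment> \<open>In the abnormal case all multipliers would vanish, against the unit norm of the
    limit.\<close>
  have "r0 \<noteq> 0"
  proof
    assume r: "r0 = 0"
    have "0 \<le> u0" using S0 by (auto simp: S_p_def KKT_def)
    with fj0 r have "\<alpha>0 = 0 \<and> \<beta>0 = 0 \<and> \<gamma>0 = 0"
      using fritz_john_abnormal_trivial convex_f convex_g upper_regular A1[OF S0] A2[OF S0] by blast
    with r norm0 show False by simp
  qed
  with r0 fritz_john_scaleR[OF fj0, of "inverse r0"]
  have "fritz_john 1 xbar y0 u0 (\<alpha>0 /\<^sub>R r0) (\<beta>0 /\<^sub>R r0) (\<gamma>0 /\<^sub>R r0)" by simp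
  then show ?thesis using S0 by (rule C_stationary_if_fritz_john)
qed

end

section \<open>Extraction of the derivatives and conclusion\<close>

text \<open>Continuity of \<open>h'\<close> comes from its differentiability.\<close>

lemma twice_cont_diffE:
  assumes "twice_cont_diff h"
  obtains h' h'' where "\<And>z. (h has_derivative blinfun_apply (h' z)) (at z)"
    "\<And>z. (h' has_derivative blinfun_apply (h'' z)) (at z)"
    "\<And>z. isCont h' z" "\<And>z. isCont h'' z"
proof -
  obtain h' h'' where h: "\<And>z. (h has_derivative blinfun_apply (h' z)) (at z)"
    "\<And>z. (h' has_derivative blinfun_apply (h'' z)) (at z)" "continuous_on UNIV h''"
    using assms unfolding twice_cont_diff_def by blast
  have "isCont h' z" "isCont h'' z" for z
    using has_derivative_continuous[OF h(2)] h(3) by (simp_all add: continuous_on_eq_continuous_at)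
  with h that show ?thesis by blast
qed

theorem theorem4p3:
  fixes F f :: "(real ^ 'n) \<times> (real ^ 'm) \<Rightarrow> real"
    and G :: "real ^ 'n \<Rightarrow> real ^ 'p"
    and g :: "(real ^ 'n) \<times> (real ^ 'm) \<Rightarrow> real ^ 'q"
    and t :: "nat \<Rightarrow> real"
    and xs :: "nat \<Rightarrow> real ^ 'n"
    and xbar :: "real ^ 'n"
  assumes smooth: "twice_cont_diff F" "twice_cont_diff f" "twice_cont_diff G" "twice_cont_diff g"
    and solvable: "\<And>x. x \<in> upper_feasible G \<Longrightarrow> lower_solutions f g x \<noteq> {}"
      "\<And>x. x \<notin> upper_feasible G \<Longrightarrow> lower_solutions f g x = {}"
    and convex_f: "\<And>x. convex_on UNIV (\<lambda>y. f (x, y))"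
    and convex_g: "\<And>x i. convex_on UNIV (\<lambda>y. g (x, y) $ i)"
    and slater: "\<And>x. x \<in> upper_feasible G \<Longrightarrow> \<exists>y. \<forall>i. g (x, y) $ i < 0"
    and relaxed_nonempty: "\<And>s x. s > 0 \<Longrightarrow> x \<in> upper_feasible G \<Longrightarrow> KKT_relaxed f g s x \<noteq> {}"
    and t_pos: "\<And>k. t k > 0"
    and t_dec: "decseq t"
    and t_lim: "t \<longlonglongrightarrow> 0"
    and stationary: "\<And>k. relaxed_stationary F f G g (t k) (xs k)"
    and xs_lim: "xs \<longlonglongrightarrow> xbar"
    and S_p_xbar: "S_p F f g xbar \<noteq> {}" "compact (S_p F f g xbar)"
    and upper_regular: "upper_level_regular G xbar"
    and A1: "\<And>y u. (y, u) \<in> S_p F f g xbar \<Longrightarrow> A1m f g xbar y u"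
    and A2: "\<And>y u. (y, u) \<in> S_p F f g xbar \<Longrightarrow> A2m f g xbar y u"
    and excess_lim: "(\<lambda>k. excess (S_p_relaxed F f g (t k) (xs k)) (S_p F f g xbar)) \<longlonglongrightarrow> 0"
  shows "C_stationary F f G g xbar"
proof -
  obtain F' F'' where F: "\<And>z. (F has_derivative blinfun_apply (F' z)) (at z)"
    "\<And>z. (F' has_derivative blinfun_apply (F'' z)) (at z)" "\<And>z. isCont F' z" "\<And>z. isCont F'' z"
    using twice_cont_diffE[OF smooth(1)] by blast
  obtain f' f'' where f: "\<And>z. (f has_derivative blinfun_apply (f' z)) (at z)"
    "\<And>z. (f' has_derivative blinfun_apply (f'' z)) (at z)" "\<And>z. isCont f' z" "\<And>z. isCont f'' z"
    using twice_cont_diffE[OF smooth(2)] by blast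
  obtain G' G'' where G: "\<And>z. (G has_derivative blinfun_apply (G' z)) (at z)"
    "\<And>z. (G' has_derivative blinfun_apply (G'' z)) (at z)" "\<And>z. isCont G' z" "\<And>z. isCont G'' z"
    using twice_cont_diffE[OF smooth(3)] by blast
  obtain g' g'' where g: "\<And>z. (g has_derivative blinfun_apply (g' z)) (at z)"
    "\<And>z. (g' has_derivative blinfun_apply (g'' z)) (at z)" "\<And>z. isCont g' z" "\<And>z. isCont g'' z"
    using twice_cont_diffE[OF smooth(4)] by blast
  interpret C2_bilevel F f G g F' f' G' g' f'' g''
    by unfold_locales (fact F f G g)+
  show ?thesis
    using C_stationary_limit[OF convex_f convex_g t_pos stationary xs_lim S_p_xbar upper_regular A1 A2
      excess_lim] .
qed

end
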